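(* Let $R$ be a ring with an automorphism $\sigma$, $\sigma\neq \mathrm{id}_R$, $\sigma\neq 0$, and suppose that the classical left quotient ring $Q(R)$ of $R$ exists. Let $\bar\sigma$ be the automorphism of $Q(R)$ given by $\bar\sigma(b^{-1}a)=\sigma(b)^{-1}\sigma(a)$ for $a,b\in R$ with $b$ regular. Then $R$ is strongly $\sigma$-symmetric if and only if $Q(R)$ is strongly $\bar\sigma$-symmetric.
   Context: Rings are associative with identity, not necessarily commutative. For a ring $T$ and a ring endomorphism $\tau$ of $T$ with $\tau(1)=1$, the skew polynomial ring $T[x;\tau]$ consists of polynomials $\sum a_i x^i$ with $a_i\in T$, usual addition, and multiplication determined by $xr=\tau(r)x$ for $r\in T$. A ring is symmetric if $abc=0$ implies $acb=0$ for all elements $a,b,c$. $T$ is strongly $\tau$-symmetric if $T[x;\tau]$ is symmetric. An element $u\in R$ is regular if $ur=0$ implies $r=0$ and $ru=0$ implies $r=0$, for $r\in R$. The classical left quotient ring $Q(R)$ (when it exists) is the left Ore localization of $R$ at the set of all regular elements: a ring containing $R$ in which every regular element of $R$ is invertible and every element has the form $b^{-1}a$ with $a,b\in R$, $b$ regular. *)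

theory Defs
  imports "HOL-Algebra.UnivPoly" "HOL-Algebra.QuotRing"
begin

text \<open>
  Elements of the skew polynomial ring \<open>T[x;\<tau>]\<close> are coefficient sequences of finite support, with
  \<open>p\<close> standing for the sum of the \<open>p i x\<^sup>i\<close>. Iterating \<open>x r = \<tau>(r) x\<close> gives
  \<open>(a x\<^sup>i) (b x\<^sup>j) = a \<tau>\<^sup>i(b) x\<^sup>i\<^sup>+\<^sup>j\<close>, hence the multiplication below.
\<close>
definition skew_poly :: "('a, 'm) ring_scheme \<Rightarrow> ('a \<Rightarrow> 'a) \<Rightarrow> (nat \<Rightarrow> 'a) ring"
  where "skew_poly T \<tau> = \<lparr>
    carrier = up T,
    mult = (\<lambda>p\<in>up T. \<lambda>q\<in>up T. \<lambda>n. \<Oplus>\<^bsub>T\<^esub>i \<in> {..n}. p i \<otimes>\<^bsub>T\<^esub> (\<tau> ^^ i) (q (n - i))),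
    one = (\<lambda>i. if i = 0 then \<one>\<^bsub>T\<^esub> else \<zero>\<^bsub>T\<^esub>),
    zero = (\<lambda>i. \<zero>\<^bsub>T\<^esub>),
    add = (\<lambda>p\<in>up T. \<lambda>q\<in>up T. \<lambda>i. p i \<oplus>\<^bsub>T\<^esub> q i)\<rparr>"

definition symmetric_ring :: "('a, 'm) ring_scheme \<Rightarrow> bool"
  where "symmetric_ring S \<longleftrightarrow>
    (\<forall>a\<in>carrier S. \<forall>b\<in>carrier S. \<forall>c\<in>carrier S.
       a \<otimes>\<^bsub>S\<^esub> b \<otimes>\<^bsub>S\<^esub> c = \<zero>\<^bsub>S\<^esub> \<longrightarrow> a \<otimes>\<^bsub>S\<^esub> c \<otimes>\<^bsub>S\<^esub> b = \<zero>\<^bsub>S\<^esub>)"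

definition strongly_symmetric :: "('a, 'm) ring_scheme \<Rightarrow> ('a \<Rightarrow> 'a) \<Rightarrow> bool"
  where "strongly_symmetric T \<tau> \<longleftrightarrow> symmetric_ring (skew_poly T \<tau>)"

definition regular_elements :: "('a, 'm) ring_scheme \<Rightarrow> 'a set"
  where "regular_elements R = {u \<in> carrier R. \<forall>r\<in>carrier R.
    (u \<otimes>\<^bsub>R\<^esub> r = \<zero>\<^bsub>R\<^esub> \<longrightarrow> r = \<zero>\<^bsub>R\<^esub>) \<and> (r \<otimes>\<^bsub>R\<^esub> u = \<zero>\<^bsub>R\<^esub> \<longrightarrow> r = \<zero>\<^bsub>R\<^esub>)}"

text \<open>
  The containment of \<open>R\<close> in its quotient ring \<open>Q\<close> is given by an injective ring homomorphism \<open>\<iota>\<close>.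
\<close>
definition classical_left_quotient_ring ::
    "('a, 'm) ring_scheme \<Rightarrow> ('b, 'n) ring_scheme \<Rightarrow> ('a \<Rightarrow> 'b) \<Rightarrow> bool"
  where "classical_left_quotient_ring R Q \<iota> \<longleftrightarrow>
    ring Q \<and> \<iota> \<in> ring_hom R Q \<and> inj_on \<iota> (carrier R) \<and>
    (\<forall>u\<in>regular_elements R. \<iota> u \<in> Units Q) \<and>
    (\<forall>q\<in>carrier Q. \<exists>a\<in>carrier R. \<exists>b\<in>regular_elements R. q = inv\<^bsub>Q\<^esub> (\<iota> b) \<otimes>\<^bsub>Q\<^esub> \<iota> a)"

text \<open>
  The map \<open>b\<^sup>-\<^sup>1 a \<mapsto> \<sigma>(b)\<^sup>-\<^sup>1 \<sigma>(a)\<close> on \<open>Q\<close>. Its independence of the chosen fraction and the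
  fact that it is an automorphism are \<open>quotient_extension_frac\<close> and \<open>quotient_extension_iso\<close> below.
\<close>
definition quotient_extension ::
    "('a, 'm) ring_scheme \<Rightarrow> ('b, 'n) ring_scheme \<Rightarrow> ('a \<Rightarrow> 'b) \<Rightarrow> ('a \<Rightarrow> 'a) \<Rightarrow> 'b \<Rightarrow> 'b"
  where "quotient_extension R Q \<iota> \<sigma> q =
    (THE q'. \<exists>a\<in>carrier R. \<exists>b\<in>regular_elements R.
       q = inv\<^bsub>Q\<^esub> (\<iota> b) \<otimes>\<^bsub>Q\<^esub> \<iota> a \<and> q' = inv\<^bsub>Q\<^esub> (\<iota> (\<sigma> b)) \<otimes>\<^bsub>Q\<^esub> \<iota> (\<sigma> a))"


locale quotient_setup = R?: ring R + Q?: ring Q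
  for R :: "('a, 'm) ring_scheme" (structure) and Q :: "('b, 'n) ring_scheme" (structure)
    and \<iota> :: "'a \<Rightarrow> 'b" and \<sigma> :: "'a \<Rightarrow> 'a" +
  assumes quot: "classical_left_quotient_ring R Q \<iota>"
    and aut: "\<sigma> \<in> ring_iso R R"
begin

lemma iota_hom: "\<iota> \<in> ring_hom R Q"
  and iota_inj: "inj_on \<iota> (carrier R)"
  and iota_unit: "u \<in> regular_elements R \<Longrightarrow> \<iota> u \<in> Units Q"
  using quot by (auto simp: classical_left_quotient_ring_def)

lemma fracE:
  assumes "q \<in> carrier Q"
  obtains a b where "a \<in> carrier R" "b \<in> regular_elements R" "q = inv\<^bsub>Q\<^esub> (\<iota> b) \<otimes>\<^bsub>Q\<^esub> \<iota> a"
  using assms quot by (auto simp: classical_left_quotient_ring_def)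

lemma sigma_hom: "\<sigma> \<in> ring_hom R R" and sigma_bij: "bij_betw \<sigma> (carrier R) (carrier R)"
  using aut by (auto simp: ring_iso_def)

lemmas iota_simps [simp] = ring_hom_memE[OF iota_hom]
lemmas sigma_simps [simp] = ring_hom_memE[OF sigma_hom]

lemma sigma_zero [simp]: "\<sigma> \<zero>\<^bsub>R\<^esub> = \<zero>\<^bsub>R\<^esub>"
  using ring_hom_zero[OF sigma_hom] R.ring_axioms by blast

lemma iota_zero [simp]: "\<iota> \<zero>\<^bsub>R\<^esub> = \<zero>\<^bsub>Q\<^esub>"
  using ring_hom_zero[OF iota_hom] R.ring_axioms Q.ring_axioms by blast

lemma regular_closed [simp]: "b \<in> regular_elements R \<Longrightarrow> b \<in> carrier R"
  by (simp add: regular_elements_def)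

lemma sigma_eq_zero: "r \<in> carrier R \<Longrightarrow> \<sigma> r = \<zero>\<^bsub>R\<^esub> \<longleftrightarrow> r = \<zero>\<^bsub>R\<^esub>"
  using sigma_bij by (metis bij_betw_imp_inj_on inj_on_contraD R.zero_closed sigma_zero)

lemma sigma_surj: 
  assumes "r \<in> carrier R" obtains s where "s \<in> carrier R" "\<sigma> s = r"
  using sigma_bij assms by (metis bij_betw_imp_surj_on imageE)

lemma regularD:
  assumes "u \<in> regular_elements R" "r \<in> carrier R"
  shows "u \<otimes>\<^bsub>R\<^esub> r = \<zero>\<^bsub>R\<^esub> \<Longrightarrow> r = \<zero>\<^bsub>R\<^esub>" "r \<otimes>\<^bsub>R\<^esub> u = \<zero>\<^bsub>R\<^esub> \<Longrightarrow> r = \<zero>\<^bsub>R\<^esub>"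
  using assms unfolding regular_elements_def by blast+

lemma regularI:
  assumes "u \<in> carrier R"
    and "\<And>r. r \<in> carrier R \<Longrightarrow> u \<otimes>\<^bsub>R\<^esub> r = \<zero>\<^bsub>R\<^esub> \<Longrightarrow> r = \<zero>\<^bsub>R\<^esub>"
    and "\<And>r. r \<in> carrier R \<Longrightarrow> r \<otimes>\<^bsub>R\<^esub> u = \<zero>\<^bsub>R\<^esub> \<Longrightarrow> r = \<zero>\<^bsub>R\<^esub>"
  shows "u \<in> regular_elements R"
  using assms unfolding regular_elements_def by blast

lemma sigma_regular_iff:
  assumes u: "u \<in> carrier R"
  shows "\<sigma> u \<in> regular_elements R \<longleftrightarrow> u \<in> regular_elements R"
proof
  assume reg: "\<sigma> u \<in> regular_elements R"
  show "u \<in> regular_elements R"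
  proof (rule regularI[OF u])
    fix r assume r: "r \<in> carrier R"
    show "r = \<zero>\<^bsub>R\<^esub>" if "u \<otimes>\<^bsub>R\<^esub> r = \<zero>\<^bsub>R\<^esub>"
      using regularD(1)[OF reg sigma_simps(1)[OF r]] that sigma_simps(2)[OF u r] sigma_eq_zero[OF r]
        sigma_zero by metis
    show "r = \<zero>\<^bsub>R\<^esub>" if "r \<otimes>\<^bsub>R\<^esub> u = \<zero>\<^bsub>R\<^esub>"
      using regularD(2)[OF reg sigma_simps(1)[OF r]] that sigma_simps(2)[OF r u] sigma_eq_zero[OF r]
        sigma_zero by metis
  qed
next
  assume reg: "u \<in> regular_elements R"
  show "\<sigma> u \<in> regular_elements R"
  proof (rule regularI)
    fix r assume r: "r \<in> carrier R"
    obtain s where s: "s \<in> carrier R" "\<sigma> s = r" using sigma_surj r by blast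
    show "r = \<zero>\<^bsub>R\<^esub>" if "\<sigma> u \<otimes>\<^bsub>R\<^esub> r = \<zero>\<^bsub>R\<^esub>"
    proof -
      have "\<sigma> (u \<otimes>\<^bsub>R\<^esub> s) = \<zero>\<^bsub>R\<^esub>" using that u s by simp
      then have "u \<otimes>\<^bsub>R\<^esub> s = \<zero>\<^bsub>R\<^esub>" using u s sigma_eq_zero by blast
      then have "s = \<zero>\<^bsub>R\<^esub>" by (rule regularD(1)[OF reg s(1)])
      then show ?thesis using s by simp
    qed
    show "r = \<zero>\<^bsub>R\<^esub>" if "r \<otimes>\<^bsub>R\<^esub> \<sigma> u = \<zero>\<^bsub>R\<^esub>"
    proof -
      have "\<sigma> (s \<otimes>\<^bsub>R\<^esub> u) = \<zero>\<^bsub>R\<^esub>" using that u s by simp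
      then have "s \<otimes>\<^bsub>R\<^esub> u = \<zero>\<^bsub>R\<^esub>" using u s sigma_eq_zero by blast
      then have "s = \<zero>\<^bsub>R\<^esub>" by (rule regularD(2)[OF reg s(1)])
      then show ?thesis using s by simp
    qed
  qed (use u in simp)
qed

lemma iota_inj_eq: "\<iota> a = \<iota> b \<Longrightarrow> a \<in> carrier R \<Longrightarrow> b \<in> carrier R \<Longrightarrow> a = b"
  using iota_inj by (auto dest: inj_onD)

lemma frac_iff:
  assumes "b \<in> regular_elements R" "a \<in> carrier Q" "q \<in> carrier Q"
  shows "q = inv\<^bsub>Q\<^esub> (\<iota> b) \<otimes>\<^bsub>Q\<^esub> a \<longleftrightarrow> \<iota> b \<otimes>\<^bsub>Q\<^esub> q = a"
proof -
  have u: "\<iota> b \<in> Units Q" using iota_unit assms by blast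
  note c = Q.Units_closed[OF u] Q.Units_inv_closed[OF u]
  show ?thesis
    using u c assms
    by (metis Q.Units_l_inv Q.Units_r_inv Q.l_one Q.m_assoc)
qed

lemma unit_cancel:
  "b \<in> regular_elements R \<Longrightarrow> x \<in> carrier Q \<Longrightarrow> y \<in> carrier Q \<Longrightarrow>
    \<iota> b \<otimes>\<^bsub>Q\<^esub> x = \<iota> b \<otimes>\<^bsub>Q\<^esub> y \<Longrightarrow> x = y"
  using frac_iff Q.Units_l_cancel iota_unit by blast

lemma left_ore:
  assumes "a \<in> carrier R" "d \<in> regular_elements R"
  obtains e f where "e \<in> regular_elements R" "f \<in> carrier R" "e \<otimes>\<^bsub>R\<^esub> a = f \<otimes>\<^bsub>R\<^esub> d"
proof -
  have u: "\<iota> d \<in> Units Q" using iota_unit assms by blast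
  define x where "x = \<iota> a \<otimes>\<^bsub>Q\<^esub> inv\<^bsub>Q\<^esub> (\<iota> d)"
  have x: "x \<in> carrier Q" using u assms by (simp add: x_def)
  then obtain f e where fe: "f \<in> carrier R" "e \<in> regular_elements R" "x = inv\<^bsub>Q\<^esub> (\<iota> e) \<otimes>\<^bsub>Q\<^esub> \<iota> f"
    by (rule fracE)
  then have ex: "\<iota> e \<otimes>\<^bsub>Q\<^esub> x = \<iota> f" using frac_iff x by auto
  have "x \<otimes>\<^bsub>Q\<^esub> \<iota> d = \<iota> a" using u assms by (simp add: x_def Q.m_assoc)
  then have "\<iota> e \<otimes>\<^bsub>Q\<^esub> \<iota> a = \<iota> f \<otimes>\<^bsub>Q\<^esub> \<iota> d"
    using ex x fe assms by (metis Q.m_assoc iota_simps(1) regular_closed)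
  then have "\<iota> (e \<otimes>\<^bsub>R\<^esub> a) = \<iota> (f \<otimes>\<^bsub>R\<^esub> d)" using fe assms by simp
  then have "e \<otimes>\<^bsub>R\<^esub> a = f \<otimes>\<^bsub>R\<^esub> d" using fe assms by (intro iota_inj_eq) auto
  then show ?thesis using that fe by blast
qed

lemma transfer_aux:
  assumes b: "b \<in> regular_elements R" and a: "a \<in> carrier R" and q: "q \<in> carrier Q"
    and q': "q' \<in> carrier Q"
    and 1: "\<iota> b \<otimes>\<^bsub>Q\<^esub> q = \<iota> a" and 2: "\<iota> (\<sigma> b) \<otimes>\<^bsub>Q\<^esub> q' = \<iota> (\<sigma> a)"
    and s: "s \<in> carrier R" and t: "t \<in> carrier R" and 3: "\<iota> s \<otimes>\<^bsub>Q\<^esub> q = \<iota> t"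
  shows "\<iota> (\<sigma> s) \<otimes>\<^bsub>Q\<^esub> q' = \<iota> (\<sigma> t)"
proof -
  obtain e f where ef: "e \<in> regular_elements R" "f \<in> carrier R" "e \<otimes>\<^bsub>R\<^esub> s = f \<otimes>\<^bsub>R\<^esub> b"
    using left_ore[OF s b] by blast
  have "\<iota> (e \<otimes>\<^bsub>R\<^esub> t) = \<iota> (e \<otimes>\<^bsub>R\<^esub> s) \<otimes>\<^bsub>Q\<^esub> q" using ef(1) s t q 3 by (simp add: Q.m_assoc)
  also have "\<dots> = \<iota> (f \<otimes>\<^bsub>R\<^esub> a)" unfolding ef(3) using ef(2) a b q 1 by (simp add: Q.m_assoc)
  finally have et: "e \<otimes>\<^bsub>R\<^esub> t = f \<otimes>\<^bsub>R\<^esub> a" using ef t a by (intro iota_inj_eq) auto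
  have "\<iota> (\<sigma> e) \<otimes>\<^bsub>Q\<^esub> \<iota> (\<sigma> t) = \<iota> (\<sigma> (e \<otimes>\<^bsub>R\<^esub> t))" using ef t by simp
  also have "\<dots> = \<iota> (\<sigma> f) \<otimes>\<^bsub>Q\<^esub> (\<iota> (\<sigma> b) \<otimes>\<^bsub>Q\<^esub> q')" unfolding et using ef(2) a 2 by simp
  also have "\<dots> = \<iota> (\<sigma> (f \<otimes>\<^bsub>R\<^esub> b)) \<otimes>\<^bsub>Q\<^esub> q'" using ef(2) b q' by (simp add: Q.m_assoc)
  also have "\<dots> = \<iota> (\<sigma> e) \<otimes>\<^bsub>Q\<^esub> (\<iota> (\<sigma> s) \<otimes>\<^bsub>Q\<^esub> q')"
    unfolding ef(3)[symmetric] using ef(1) s q' by (simp add: Q.m_assoc)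
  finally show ?thesis
    using unit_cancel[of "\<sigma> e"] ef(1) sigma_regular_iff[of e] s t q' by simp
qed

abbreviation sbar where "sbar \<equiv> quotient_extension R Q \<iota> \<sigma>"

lemma quotient_extension_frac:
  assumes a: "a \<in> carrier R" and b: "b \<in> regular_elements R"
  shows "sbar (inv\<^bsub>Q\<^esub> (\<iota> b) \<otimes>\<^bsub>Q\<^esub> \<iota> a) = inv\<^bsub>Q\<^esub> (\<iota> (\<sigma> b)) \<otimes>\<^bsub>Q\<^esub> \<iota> (\<sigma> a)"
  unfolding quotient_extension_def
proof (rule the_equality)
  let ?q = "inv\<^bsub>Q\<^esub> (\<iota> b) \<otimes>\<^bsub>Q\<^esub> \<iota> a" and ?q' = "inv\<^bsub>Q\<^esub> (\<iota> (\<sigma> b)) \<otimes>\<^bsub>Q\<^esub> \<iota> (\<sigma> a)"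
  show "\<exists>a'\<in>carrier R. \<exists>b'\<in>regular_elements R.
    ?q = inv\<^bsub>Q\<^esub> (\<iota> b') \<otimes>\<^bsub>Q\<^esub> \<iota> a' \<and> ?q' = inv\<^bsub>Q\<^esub> (\<iota> (\<sigma> b')) \<otimes>\<^bsub>Q\<^esub> \<iota> (\<sigma> a')" using a b by blast
  fix q'' assume "\<exists>a'\<in>carrier R. \<exists>b'\<in>regular_elements R.
    ?q = inv\<^bsub>Q\<^esub> (\<iota> b') \<otimes>\<^bsub>Q\<^esub> \<iota> a' \<and> q'' = inv\<^bsub>Q\<^esub> (\<iota> (\<sigma> b')) \<otimes>\<^bsub>Q\<^esub> \<iota> (\<sigma> a')"
  then obtain a' b' where c: "a' \<in> carrier R" "b' \<in> regular_elements R"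
    "?q = inv\<^bsub>Q\<^esub> (\<iota> b') \<otimes>\<^bsub>Q\<^esub> \<iota> a'" "q'' = inv\<^bsub>Q\<^esub> (\<iota> (\<sigma> b')) \<otimes>\<^bsub>Q\<^esub> \<iota> (\<sigma> a')" by blast
  have sb: "\<sigma> b \<in> regular_elements R" "\<sigma> b' \<in> regular_elements R"
    using b c(2) sigma_regular_iff by auto
  have cl: "?q \<in> carrier Q" "?q' \<in> carrier Q" "q'' \<in> carrier Q"
    using a b c sb iota_unit by auto
  have 1: "\<iota> b \<otimes>\<^bsub>Q\<^esub> ?q = \<iota> a" using frac_iff[OF b _ cl(1), of "\<iota> a"] a by simp
  have 2: "\<iota> (\<sigma> b) \<otimes>\<^bsub>Q\<^esub> ?q' = \<iota> (\<sigma> a)"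
    using frac_iff[OF sb(1) _ cl(2), of "\<iota> (\<sigma> a)"] a by simp
  have 3: "\<iota> b' \<otimes>\<^bsub>Q\<^esub> ?q = \<iota> a'" using frac_iff[OF c(2) _ cl(1), of "\<iota> a'"] c by simp
  have "\<iota> (\<sigma> b') \<otimes>\<^bsub>Q\<^esub> ?q' = \<iota> (\<sigma> a')"
    using transfer_aux[OF b a cl(1,2) 1 2 _ c(1) 3] c(2) by simp
  then show "q'' = ?q'" using frac_iff[OF sb(2) _ cl(2), of "\<iota> (\<sigma> a')"] c by simp
qed

lemma sbar_closed: "q \<in> carrier Q \<Longrightarrow> sbar q \<in> carrier Q"
  using quotient_extension_frac iota_unit sigma_regular_iff
  by (metis Q.Units_inv_closed Q.m_closed fracE iota_simps(1) regular_closed sigma_simps(1))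

lemma sbar_transfer:
  assumes q: "q \<in> carrier Q" and s: "s \<in> carrier R" and t: "t \<in> carrier R"
    and 3: "\<iota> s \<otimes>\<^bsub>Q\<^esub> q = \<iota> t"
  shows "\<iota> (\<sigma> s) \<otimes>\<^bsub>Q\<^esub> sbar q = \<iota> (\<sigma> t)"
proof -
  obtain a b where ab: "a \<in> carrier R" "b \<in> regular_elements R" "q = inv\<^bsub>Q\<^esub> (\<iota> b) \<otimes>\<^bsub>Q\<^esub> \<iota> a"
    using q by (rule fracE)
  have sb: "\<sigma> b \<in> regular_elements R" using ab sigma_regular_iff by auto
  have "\<iota> b \<otimes>\<^bsub>Q\<^esub> q = \<iota> a" using ab q frac_iff by auto
  moreover have "\<iota> (\<sigma> b) \<otimes>\<^bsub>Q\<^esub> sbar q = \<iota> (\<sigma> a)"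
    using quotient_extension_frac[OF ab(1,2)] ab(1)
      frac_iff[OF sb _ sbar_closed[OF q], of "\<iota> (\<sigma> a)"]
    unfolding ab(3)[symmetric] by simp
  ultimately show ?thesis using transfer_aux ab q sbar_closed[OF q] s t 3 by blast
qed

lemma denomE:
  assumes "q \<in> carrier Q"
  obtains a b where "a \<in> carrier R" "b \<in> regular_elements R" "\<iota> b \<otimes>\<^bsub>Q\<^esub> q = \<iota> a"
  using assms by (metis fracE frac_iff iota_simps(1))

lemma sbar_cancel:
  assumes "b \<in> regular_elements R" "e \<in> regular_elements R" "x \<in> carrier Q" "y \<in> carrier Q"
    "\<iota> (\<sigma> (e \<otimes>\<^bsub>R\<^esub> b)) \<otimes>\<^bsub>Q\<^esub> x = \<iota> (\<sigma> (e \<otimes>\<^bsub>R\<^esub> b)) \<otimes>\<^bsub>Q\<^esub> y"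
  shows "x = y"
proof -
  have r: "\<sigma> b \<in> regular_elements R" "\<sigma> e \<in> regular_elements R"
    using assms(1,2) sigma_regular_iff by auto
  have "\<iota> (\<sigma> e) \<otimes>\<^bsub>Q\<^esub> (\<iota> (\<sigma> b) \<otimes>\<^bsub>Q\<^esub> x) = \<iota> (\<sigma> e) \<otimes>\<^bsub>Q\<^esub> (\<iota> (\<sigma> b) \<otimes>\<^bsub>Q\<^esub> y)"
    using assms by (simp add: Q.m_assoc)
  then have "\<iota> (\<sigma> b) \<otimes>\<^bsub>Q\<^esub> x = \<iota> (\<sigma> b) \<otimes>\<^bsub>Q\<^esub> y"
    using unit_cancel[OF r(2)] assms by simp
  then show ?thesis using unit_cancel[OF r(1)] assms by simp
qed

lemma sbar_hom: "sbar \<in> ring_hom Q Q"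
proof (rule ring_hom_memI)
  fix p q assume p: "p \<in> carrier Q" and q: "q \<in> carrier Q"
  note cl = p q sbar_closed[OF p] sbar_closed[OF q]
  obtain a b where ab: "a \<in> carrier R" "b \<in> regular_elements R" "\<iota> b \<otimes>\<^bsub>Q\<^esub> p = \<iota> a"
    using p by (rule denomE)
  obtain c d where cd: "c \<in> carrier R" "d \<in> regular_elements R" "\<iota> d \<otimes>\<^bsub>Q\<^esub> q = \<iota> c"
    using q by (rule denomE)
  have P: "\<iota> (\<sigma> b) \<otimes>\<^bsub>Q\<^esub> sbar p = \<iota> (\<sigma> a)" and Q: "\<iota> (\<sigma> d) \<otimes>\<^bsub>Q\<^esub> sbar q = \<iota> (\<sigma> c)"
    using sbar_transfer ab cd p q by auto
  show "sbar (p \<otimes>\<^bsub>Q\<^esub> q) = sbar p \<otimes>\<^bsub>Q\<^esub> sbar q"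
  proof -
    obtain e f where ef: "e \<in> regular_elements R" "f \<in> carrier R" "e \<otimes>\<^bsub>R\<^esub> a = f \<otimes>\<^bsub>R\<^esub> d"
      using left_ore[OF ab(1) cd(2)] by blast
    have "\<iota> (e \<otimes>\<^bsub>R\<^esub> b) \<otimes>\<^bsub>Q\<^esub> (p \<otimes>\<^bsub>Q\<^esub> q) = \<iota> e \<otimes>\<^bsub>Q\<^esub> (\<iota> b \<otimes>\<^bsub>Q\<^esub> p) \<otimes>\<^bsub>Q\<^esub> q"
      using ef ab(2) p q by (simp add: Q.m_assoc)
    also have "\<dots> = \<iota> (e \<otimes>\<^bsub>R\<^esub> a) \<otimes>\<^bsub>Q\<^esub> q" using ef(1) ab by simp
    also have "\<dots> = \<iota> (f \<otimes>\<^bsub>R\<^esub> c)" unfolding ef(3) using ef(2) cd q by (simp add: Q.m_assoc)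
    finally have "\<iota> (\<sigma> (e \<otimes>\<^bsub>R\<^esub> b)) \<otimes>\<^bsub>Q\<^esub> sbar (p \<otimes>\<^bsub>Q\<^esub> q) = \<iota> (\<sigma> (f \<otimes>\<^bsub>R\<^esub> c))"
      using ef ab cd p q by (intro sbar_transfer) auto
    also have "\<dots> = \<iota> (\<sigma> (f \<otimes>\<^bsub>R\<^esub> d)) \<otimes>\<^bsub>Q\<^esub> sbar q"
      using ef(2) cd cl Q by (simp add: Q.m_assoc)
    also have "\<dots> = \<iota> (\<sigma> e) \<otimes>\<^bsub>Q\<^esub> (\<iota> (\<sigma> b) \<otimes>\<^bsub>Q\<^esub> sbar p) \<otimes>\<^bsub>Q\<^esub> sbar q"
      unfolding ef(3)[symmetric] P using ef(1) ab by simp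
    also have "\<dots> = \<iota> (\<sigma> (e \<otimes>\<^bsub>R\<^esub> b)) \<otimes>\<^bsub>Q\<^esub> (sbar p \<otimes>\<^bsub>Q\<^esub> sbar q)"
      using ef(1) ab(2) cl by (simp add: Q.m_assoc)
    finally show ?thesis
      using sbar_cancel[OF ab(2) ef(1)] cl sbar_closed[of "p \<otimes>\<^bsub>Q\<^esub> q"] by simp
  qed
  show "sbar (p \<oplus>\<^bsub>Q\<^esub> q) = sbar p \<oplus>\<^bsub>Q\<^esub> sbar q"
  proof -
    obtain e f where ef: "e \<in> regular_elements R" "f \<in> carrier R" "e \<otimes>\<^bsub>R\<^esub> b = f \<otimes>\<^bsub>R\<^esub> d"
      using left_ore[of b d] ab cd by auto
    have gp: "\<iota> (e \<otimes>\<^bsub>R\<^esub> b) \<otimes>\<^bsub>Q\<^esub> p = \<iota> (e \<otimes>\<^bsub>R\<^esub> a)"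
      using ef(1) ab p by (simp add: Q.m_assoc)
    have gq: "\<iota> (e \<otimes>\<^bsub>R\<^esub> b) \<otimes>\<^bsub>Q\<^esub> q = \<iota> (f \<otimes>\<^bsub>R\<^esub> c)"
      unfolding ef(3) using ef(2) cd q by (simp add: Q.m_assoc)
    have g: "e \<otimes>\<^bsub>R\<^esub> b \<in> carrier R" using ef(1) ab by simp
    have "\<iota> (e \<otimes>\<^bsub>R\<^esub> b) \<otimes>\<^bsub>Q\<^esub> (p \<oplus>\<^bsub>Q\<^esub> q) = \<iota> (e \<otimes>\<^bsub>R\<^esub> a \<oplus>\<^bsub>R\<^esub> f \<otimes>\<^bsub>R\<^esub> c)"
      using gp gq g p q ef(1,2) ab(1) cd(1) by (simp add: Q.r_distr del: iota_simps(2))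
    then have "\<iota> (\<sigma> (e \<otimes>\<^bsub>R\<^esub> b)) \<otimes>\<^bsub>Q\<^esub> sbar (p \<oplus>\<^bsub>Q\<^esub> q) = \<iota> (\<sigma> (e \<otimes>\<^bsub>R\<^esub> a \<oplus>\<^bsub>R\<^esub> f \<otimes>\<^bsub>R\<^esub> c))"
      using ef ab cd p q g by (intro sbar_transfer) auto
    also have "\<dots> = \<iota> (\<sigma> (e \<otimes>\<^bsub>R\<^esub> a)) \<oplus>\<^bsub>Q\<^esub> \<iota> (\<sigma> (f \<otimes>\<^bsub>R\<^esub> c))"
      using ef(1,2) ab(1) cd(1) by simp
    also have "\<dots> = \<iota> (\<sigma> (e \<otimes>\<^bsub>R\<^esub> b)) \<otimes>\<^bsub>Q\<^esub> sbar p \<oplus>\<^bsub>Q\<^esub> \<iota> (\<sigma> (e \<otimes>\<^bsub>R\<^esub> b)) \<otimes>\<^bsub>Q\<^esub> sbar q"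
      using sbar_transfer[OF p g _ gp] sbar_transfer[OF q g _ gq] ef(1,2) ab(1) cd(1) by simp
    also have "\<dots> = \<iota> (\<sigma> (e \<otimes>\<^bsub>R\<^esub> b)) \<otimes>\<^bsub>Q\<^esub> (sbar p \<oplus>\<^bsub>Q\<^esub> sbar q)"
      using g cl by (simp add: Q.r_distr del: sigma_simps(2))
    finally show ?thesis
      using sbar_cancel[OF ab(2) ef(1)] cl sbar_closed[of "p \<oplus>\<^bsub>Q\<^esub> q"] by simp
  qed
next
  show "sbar \<one>\<^bsub>Q\<^esub> = \<one>\<^bsub>Q\<^esub>"
    using sbar_transfer[of "\<one>\<^bsub>Q\<^esub>" "\<one>\<^bsub>R\<^esub>" "\<one>\<^bsub>R\<^esub>"] sbar_closed[of "\<one>\<^bsub>Q\<^esub>"] by simp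
qed (rule sbar_closed)

theorem quotient_extension_iso: "sbar \<in> ring_iso Q Q"
proof -
  have "inj_on sbar (carrier Q)"
  proof (rule inj_onI)
    fix p q assume p: "p \<in> carrier Q" and q: "q \<in> carrier Q" and eq: "sbar p = sbar q"
    define x where "x = p \<ominus>\<^bsub>Q\<^esub> q"
    have x: "x \<in> carrier Q" using p q by (simp add: x_def)
    have "x \<oplus>\<^bsub>Q\<^esub> q = p" using p q by (simp add: x_def a_minus_def Q.a_assoc Q.l_neg)
    then have "sbar x \<oplus>\<^bsub>Q\<^esub> sbar q = sbar q" using ring_hom_add[OF sbar_hom x q] eq by simp
    then have 0: "sbar x = \<zero>\<^bsub>Q\<^esub>"
      using sbar_closed[OF x] sbar_closed[OF q]
      by (metis Q.add.r_cancel_one)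
    obtain a b where ab: "a \<in> carrier R" "b \<in> regular_elements R" "\<iota> b \<otimes>\<^bsub>Q\<^esub> x = \<iota> a"
      using x by (rule denomE)
    have "\<iota> (\<sigma> a) = \<zero>\<^bsub>Q\<^esub>" using sbar_transfer[OF x _ ab(1,3)] ab 0 by simp
    then have "\<iota> (\<sigma> a) = \<iota> \<zero>\<^bsub>R\<^esub>" by simp
    then have "\<sigma> a = \<zero>\<^bsub>R\<^esub>" using ab(1) by (intro iota_inj_eq) auto
    then have "a = \<zero>\<^bsub>R\<^esub>" using ab(1) sigma_eq_zero by blast
    then have "x = \<zero>\<^bsub>Q\<^esub>" using ab x unit_cancel[OF ab(2) x Q.zero_closed] by simp
    then show "p = q" using \<open>x \<oplus>\<^bsub>Q\<^esub> q = p\<close> q by simp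
  qed
  moreover have "q \<in> sbar ` carrier Q" if "q \<in> carrier Q" for q
  proof -
    obtain a b where ab: "a \<in> carrier R" "b \<in> regular_elements R" "q = inv\<^bsub>Q\<^esub> (\<iota> b) \<otimes>\<^bsub>Q\<^esub> \<iota> a"
      using \<open>q \<in> carrier Q\<close> by (rule fracE)
    obtain a' where a': "a' \<in> carrier R" "\<sigma> a' = a" using sigma_surj ab by blast
    obtain b' where b': "b' \<in> carrier R" "\<sigma> b' = b" using sigma_surj[of b] ab by auto
    have r: "b' \<in> regular_elements R" using sigma_regular_iff ab b' by blast
    have "q = sbar (inv\<^bsub>Q\<^esub> (\<iota> b') \<otimes>\<^bsub>Q\<^esub> \<iota> a')" using quotient_extension_frac[OF a'(1) r] a' b' ab by simp
    moreover have "inv\<^bsub>Q\<^esub> (\<iota> b') \<otimes>\<^bsub>Q\<^esub> \<iota> a' \<in> carrier Q" using iota_unit[OF r] a' by simp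
    ultimately show ?thesis by blast
  qed
  ultimately have "bij_betw sbar (carrier Q) (carrier Q)"
    using sbar_closed by (auto simp: bij_betw_def)
  then show ?thesis using sbar_hom by (simp add: ring_iso_def)
qed

end


locale skew_setup = ring T for T :: "('a, 'm) ring_scheme" (structure) and \<tau> +
  assumes endo: "\<tau> \<in> ring_hom T T"
begin

lemma funpow_hom: "\<tau> ^^ i \<in> ring_hom T T"
proof (induction i)
  case 0 show ?case by (rule ring_hom_memI) auto
next
  case (Suc i)
  then show ?case using endo ring_hom_trans[of "\<tau> ^^ i" T T \<tau> T] by (simp add: comp_def)
qed

lemmas funpow_simps [simp] = ring_hom_memE[OF funpow_hom]

declare mem_upD [simp]

lemma funpow_zero [simp]: "(\<tau> ^^ i) \<zero> = \<zero>"
  using ring_hom_zero[OF funpow_hom] ring_axioms by blast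

lemma funpow_finsum:
  "finite A \<Longrightarrow> f \<in> A \<rightarrow> carrier T \<Longrightarrow> (\<tau> ^^ i) (finsum T f A) = finsum T (\<lambda>j. (\<tau> ^^ i) (f j)) A"
proof (induction A rule: finite_induct)
  case (insert x F)
  moreover have "(\<lambda>j. (\<tau> ^^ i) (f j)) \<in> F \<rightarrow> carrier T"
    using insert by (intro Pi_I funpow_simps(1)) auto
  ultimately show ?case by simp
qed simp

lemma finsum_triangle:
  fixes k :: nat
  assumes "\<And>i j. F i j \<in> carrier T"
  shows "(\<Oplus>j\<in>{..k}. \<Oplus>i\<in>{..j}. F i (j - i)) = (\<Oplus>i\<in>{..k}. \<Oplus>j\<in>{..k - i}. F i j)"
proof (induction k)
  case 0 then show ?case using assms by simp
next
  case (Suc k)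
  have "(\<Oplus>i\<in>{..k}. \<Oplus>j\<in>{..Suc k - i}. F i j) =
      (\<Oplus>i\<in>{..k}. F i (Suc k - i) \<oplus> (\<Oplus>j\<in>{..k - i}. F i j))"
    using assms by (intro finsum_cong') (auto simp: Suc_diff_le)
  also have "\<dots> = (\<Oplus>i\<in>{..k}. F i (Suc k - i)) \<oplus> (\<Oplus>i\<in>{..k}. \<Oplus>j\<in>{..k - i}. F i j)"
    using assms by (intro finsum_addf) auto
  finally show ?case using Suc assms by (simp add: Pi_def a_ac)
qed

abbreviation smul where "smul p q \<equiv> \<lambda>n. \<Oplus>i \<in> {..n::nat}. p i \<otimes> (\<tau> ^^ i) (q (n - i))"

lemma smul_closed:
  assumes "p \<in> up T" "q \<in> up T" shows "smul p q \<in> up T"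
proof
  show "\<And>n. smul p q n \<in> carrier T" using assms by (intro finsum_closed) auto
  obtain m n where b: "bound \<zero> m p" "bound \<zero> n q" using assms by blast
  have "bound \<zero> (m + n) (smul p q)"
  proof
    fix k assume k: "m + n < k"
    have "p i \<otimes> (\<tau> ^^ i) (q (k - i)) = \<zero>" for i
    proof (cases "m < i")
      case True then have "p i = \<zero>" using b by auto
      then show ?thesis using assms by auto
    next
      case False
      then have "n < k - i" using k by arith
      then have "q (k - i) = \<zero>" using b(2) by auto
      then show ?thesis using assms by auto
    qed
    then show "smul p q k = \<zero>" by (simp add: Pi_def)
  qed
  then show "\<exists>n. bound \<zero> n (smul p q)" ..
qed

lemma smul_assoc:
  assumes p: "p \<in> up T" and q: "q \<in> up T" and r: "r \<in> up T"
  shows "smul (smul p q) r = smul p (smul q r)"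
proof
  fix n
  define F where "F i j = p i \<otimes> (\<tau> ^^ i) (q j) \<otimes> (\<tau> ^^ (i + j)) (r (n - (i + j)))" for i j
  have F: "F i j \<in> carrier T" for i j using p q r unfolding F_def by auto
  have "smul (smul p q) r n = (\<Oplus>j\<in>{..n}. \<Oplus>i\<in>{..j}. F i (j - i))"
  proof (intro finsum_cong')
    fix j assume "j \<in> {..n}"
    have "smul p q j \<otimes> (\<tau> ^^ j) (r (n - j))
        = (\<Oplus>i\<in>{..j}. p i \<otimes> (\<tau> ^^ i) (q (j - i)) \<otimes> (\<tau> ^^ j) (r (n - j)))"
      using p q r by (intro finsum_ldistr) auto
    also have "\<dots> = (\<Oplus>i\<in>{..j}. F i (j - i))"
      using F by (intro finsum_cong') (auto simp: F_def)
    finally show "smul p q j \<otimes> (\<tau> ^^ j) (r (n - j)) = (\<Oplus>i\<in>{..j}. F i (j - i))" .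
  qed (use F in auto)
  also have "\<dots> = (\<Oplus>i\<in>{..n}. \<Oplus>j\<in>{..n - i}. F i j)" by (rule finsum_triangle[OF F])
  also have "\<dots> = smul p (smul q r) n"
  proof (intro finsum_cong')
    fix i assume "i \<in> {..n}"
    have "p i \<otimes> (\<tau> ^^ i) (smul q r (n - i)) = p i \<otimes>
        (\<Oplus>j\<in>{..n - i}. (\<tau> ^^ i) (q j \<otimes> (\<tau> ^^ j) (r (n - i - j))))"
      using q r by (subst funpow_finsum) auto
    also have "\<dots> = (\<Oplus>j\<in>{..n - i}. p i \<otimes> (\<tau> ^^ i) (q j \<otimes> (\<tau> ^^ j) (r (n - i - j))))"
      using p q r by (intro finsum_rdistr) auto
    also have "\<dots> = (\<Oplus>j\<in>{..n - i}. F i j)"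
    proof (intro finsum_cong')
      fix j
      have "q j \<in> carrier T" "r (n - i - j) \<in> carrier T" "p i \<in> carrier T" using p q r by auto
      then show "p i \<otimes> (\<tau> ^^ i) (q j \<otimes> (\<tau> ^^ j) (r (n - i - j))) = F i j"
        by (simp add: F_def m_assoc funpow_add)
    qed (use F in auto)
    finally show "(\<Oplus>j\<in>{..n - i}. F i j) = p i \<otimes> (\<tau> ^^ i) (smul q r (n - i))" ..
  next
    show "(\<lambda>i. p i \<otimes> (\<tau> ^^ i) (smul q r (n - i))) \<in> {..n} \<rightarrow> carrier T"
      using p q r by (intro Pi_I m_closed funpow_simps(1) finsum_closed) auto
  qed simp
  finally show "smul (smul p q) r n = smul p (smul q r) n" .
qed

abbreviation sone where "sone \<equiv> \<lambda>i::nat. if i = 0 then \<one> else \<zero>"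

lemma smul_one_left: assumes p: "p \<in> up T" shows "smul sone p = p"
proof
  fix n
  have "smul sone p n = (\<Oplus>i\<in>{..n}. if i = 0 then p n else \<zero>)"
    using p by (intro finsum_cong') auto
  also have "\<dots> = p n"
    using p add.finprod_singleton_swap[of 0 "{..n}" "\<lambda>_. p n"] by simp
  finally show "smul sone p n = p n" .
qed

lemma smul_one_right: assumes p: "p \<in> up T" shows "smul p sone = p"
proof
  fix n
  have "smul p sone n = (\<Oplus>i\<in>{..n}. if i = n then p i else \<zero>)"
    using p by (intro finsum_cong') (auto simp: mem_upD)
  also have "\<dots> = p n"
    using p add.finprod_singleton_swap[of n "{..n}" p] by simp
  finally show "smul p sone n = p n" .
qed

theorem skew_poly_ring: "ring (skew_poly T \<tau>)"
proof (rule ringI)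
  show "abelian_group (skew_poly T \<tau>)"
  proof (rule abelian_groupI)
    fix x assume x: "x \<in> carrier (skew_poly T \<tau>)"
    have "(\<lambda>i. \<ominus> x i) \<in> up T" using x up_a_inv_closed by (simp add: skew_poly_def)
    then show "\<exists>y\<in>carrier (skew_poly T \<tau>). y \<oplus>\<^bsub>skew_poly T \<tau>\<^esub> x = \<zero>\<^bsub>skew_poly T \<tau>\<^esub>"
      using x by (intro bexI[of _ "\<lambda>i. \<ominus> x i"]) (auto simp: skew_poly_def l_neg mem_upD)
  qed (auto simp: skew_poly_def up_add_closed intro!: a_assoc a_comm)
  show "monoid (skew_poly T \<tau>)"
    by (rule monoidI)
      (simp_all add: skew_poly_def smul_closed smul_assoc smul_one_left smul_one_right up_one_closed
        del: diff_is_0_eq)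
next
  fix p q r assume "p \<in> carrier (skew_poly T \<tau>)" "q \<in> carrier (skew_poly T \<tau>)"
    "r \<in> carrier (skew_poly T \<tau>)"
  then have c: "p \<in> up T" "q \<in> up T" "r \<in> up T" by (simp_all add: skew_poly_def)
  have "smul (\<lambda>i. p i \<oplus> q i) r n = smul p r n \<oplus> smul q r n" for n
  proof -
    have "smul (\<lambda>i. p i \<oplus> q i) r n
        = (\<Oplus>i\<in>{..n}. p i \<otimes> (\<tau> ^^ i) (r (n - i)) \<oplus> q i \<otimes> (\<tau> ^^ i) (r (n - i)))"
      using c by (intro finsum_cong') (auto simp: l_distr)
    also have "\<dots> = smul p r n \<oplus> smul q r n" using c by (intro finsum_addf) auto
    finally show ?thesis .
  qed
  then show "(p \<oplus>\<^bsub>skew_poly T \<tau>\<^esub> q) \<otimes>\<^bsub>skew_poly T \<tau>\<^esub> r =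
      p \<otimes>\<^bsub>skew_poly T \<tau>\<^esub> r \<oplus>\<^bsub>skew_poly T \<tau>\<^esub> q \<otimes>\<^bsub>skew_poly T \<tau>\<^esub> r"
    using c by (simp add: skew_poly_def smul_closed up_add_closed)
  have "smul r (\<lambda>i. p i \<oplus> q i) n = smul r p n \<oplus> smul r q n" for n
  proof -
    have "smul r (\<lambda>i. p i \<oplus> q i) n
        = (\<Oplus>i\<in>{..n}. r i \<otimes> (\<tau> ^^ i) (p (n - i)) \<oplus> r i \<otimes> (\<tau> ^^ i) (q (n - i)))"
      using c by (intro finsum_cong') (auto simp: r_distr)
    also have "\<dots> = smul r p n \<oplus> smul r q n" using c by (intro finsum_addf) auto
    finally show ?thesis .
  qed
  then show "r \<otimes>\<^bsub>skew_poly T \<tau>\<^esub> (p \<oplus>\<^bsub>skew_poly T \<tau>\<^esub> q) =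
      r \<otimes>\<^bsub>skew_poly T \<tau>\<^esub> p \<oplus>\<^bsub>skew_poly T \<tau>\<^esub> r \<otimes>\<^bsub>skew_poly T \<tau>\<^esub> q"
    using c by (simp add: skew_poly_def smul_closed up_add_closed)
qed

end

end

theory Submission
  imports Defs
begin

text \<open>
  Symmetry passes from a ring \<open>S\<close> to every ring \<open>T\<close> of left fractions \<open>c\<^sup>-\<^sup>1 s\<close>: in \<open>S\<close> a denominator
  may be inserted into or cancelled from a vanishing product, so by the left Ore condition
  \<open>p c\<^sup>-\<^sup>1 q = 0\<close> iff \<open>p q = 0\<close>, and hence \<open>c\<^sup>-\<^sup>1 f \<cdot> d\<^sup>-\<^sup>1 g \<cdot> e\<^sup>-\<^sup>1 h = 0\<close> iff \<open>f g h = 0\<close>. By common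
  denominators, \<open>Q[x;\<sigma>]\<close> is such a ring of fractions of \<open>R[x;\<sigma>]\<close>, with the regular elements of \<open>R\<close>
  as denominators.
\<close>

section \<open>Rings of left fractions\<close>

text \<open>The denominator set \<open>C\<close> is a parameter because only nonzero-divisors of
  \<open>R\<close>, viewed as constant polynomials, will serve as denominators for skew polynomials.
  The last assumption is phrased as clearing a denominator from the left, which is the form that
  common denominators deliver.\<close>

locale left_fractions = S?: ring S + T?: ring T
  for S :: "('a, 'm) ring_scheme" (structure) and T :: "('b, 'n) ring_scheme" (structure)
    and \<phi> :: "'a \<Rightarrow> 'b" and C :: "'a set" +
  assumes hom: "\<phi> \<in> ring_hom S T"
    and inj: "inj_on \<phi> (carrier S)"
    and denom_closed: "C \<subseteq> carrier S"
    and denom_unit: "c \<in> C \<Longrightarrow> \<phi> c \<in> Units T"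
    and denom_ex: "t \<in> carrier T \<Longrightarrow> \<exists>a\<in>carrier S. \<exists>c\<in>C. \<phi> c \<otimes>\<^bsub>T\<^esub> t = \<phi> a"
begin

section \<open>The embedding, units and descent of symmetry\<close>

lemmas hom_simps [simp] = ring_hom_memE[OF hom]

lemma hom_zero [simp]: "\<phi> \<zero>\<^bsub>S\<^esub> = \<zero>\<^bsub>T\<^esub>"
  using ring_hom_zero[OF hom] S.ring_axioms T.ring_axioms by blast

lemma hom_eq_zero_iff: "a \<in> carrier S \<Longrightarrow> \<phi> a = \<zero>\<^bsub>T\<^esub> \<longleftrightarrow> a = \<zero>\<^bsub>S\<^esub>"
  using inj by (metis hom_zero inj_onD S.zero_closed)

lemma denom_mem [simp]: "c \<in> C \<Longrightarrow> c \<in> carrier S"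
  using denom_closed by blast

lemma unit_mult_zero_iff:
  assumes "u \<in> Units T" "t \<in> carrier T"
  shows "u \<otimes>\<^bsub>T\<^esub> t = \<zero>\<^bsub>T\<^esub> \<longleftrightarrow> t = \<zero>\<^bsub>T\<^esub>" "t \<otimes>\<^bsub>T\<^esub> u = \<zero>\<^bsub>T\<^esub> \<longleftrightarrow> t = \<zero>\<^bsub>T\<^esub>"
proof -
  note c = T.Units_closed[OF assms(1)] T.Units_inv_closed[OF assms(1)]
  show "u \<otimes>\<^bsub>T\<^esub> t = \<zero>\<^bsub>T\<^esub> \<longleftrightarrow> t = \<zero>\<^bsub>T\<^esub>"
    using assms c by (metis T.Units_l_cancel T.r_null T.zero_closed)
  show "t \<otimes>\<^bsub>T\<^esub> u = \<zero>\<^bsub>T\<^esub> \<longleftrightarrow> t = \<zero>\<^bsub>T\<^esub>"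
    using assms c by (metis T.Units_r_inv T.l_null T.m_assoc T.r_one)
qed

lemma fraction:
  assumes "t \<in> carrier T"
  obtains a c where "a \<in> carrier S" "c \<in> C" "t = inv\<^bsub>T\<^esub> (\<phi> c) \<otimes>\<^bsub>T\<^esub> \<phi> a"
proof -
  obtain a c where ac: "a \<in> carrier S" "c \<in> C" "\<phi> c \<otimes>\<^bsub>T\<^esub> t = \<phi> a"
    using denom_ex assms by blast
  have u: "\<phi> c \<in> Units T" using ac denom_unit by blast
  have "t = inv\<^bsub>T\<^esub> (\<phi> c) \<otimes>\<^bsub>T\<^esub> (\<phi> c \<otimes>\<^bsub>T\<^esub> t)"
    using u assms T.Units_closed[OF u] by (simp add: T.m_assoc[symmetric])
  then show ?thesis using that ac by simp
qed

text \<open>Symmetry is inherited by subrings: a vanishing product is sent to \<open>T\<close>,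
  permuted there and pulled back by injectivity of \<phi>.\<close>

lemma symmetric_down:
  assumes "symmetric_ring T" shows "symmetric_ring S"
  unfolding symmetric_ring_def
proof (intro ballI impI)
  fix a b c assume abc: "a \<in> carrier S" "b \<in> carrier S" "c \<in> carrier S"
    and 0: "a \<otimes>\<^bsub>S\<^esub> b \<otimes>\<^bsub>S\<^esub> c = \<zero>\<^bsub>S\<^esub>"
  have "\<phi> a \<otimes>\<^bsub>T\<^esub> \<phi> b \<otimes>\<^bsub>T\<^esub> \<phi> c = \<phi> (a \<otimes>\<^bsub>S\<^esub> b \<otimes>\<^bsub>S\<^esub> c)" using abc by simp
  also have "\<dots> = \<zero>\<^bsub>T\<^esub>" using 0 by simp
  finally have "\<phi> a \<otimes>\<^bsub>T\<^esub> \<phi> c \<otimes>\<^bsub>T\<^esub> \<phi> b = \<zero>\<^bsub>T\<^esub>"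
    using assms abc by (simp add: symmetric_ring_def)
  then have "\<phi> (a \<otimes>\<^bsub>S\<^esub> c \<otimes>\<^bsub>S\<^esub> b) = \<zero>\<^bsub>T\<^esub>" using abc by simp
  then show "a \<otimes>\<^bsub>S\<^esub> c \<otimes>\<^bsub>S\<^esub> b = \<zero>\<^bsub>S\<^esub>" using abc hom_eq_zero_iff[of "a \<otimes>\<^bsub>S\<^esub> c \<otimes>\<^bsub>S\<^esub> b"] by simp
qed

section \<open>Denominators inside vanishing products\<close>

text \<open>Symmetry, used in both directions, moves \<open>c\<close> to the right end of the
  product, where it cancels because it becomes a unit in \<open>T\<close>.\<close>

lemma symmetric_middle_denom:
  assumes sym: "symmetric_ring S"
    and s: "s \<in> carrier S" and c: "c \<in> C" and a: "a \<in> carrier S"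
  shows "s \<otimes>\<^bsub>S\<^esub> c \<otimes>\<^bsub>S\<^esub> a = \<zero>\<^bsub>S\<^esub> \<longleftrightarrow> s \<otimes>\<^bsub>S\<^esub> a = \<zero>\<^bsub>S\<^esub>"
proof -
  have "s \<otimes>\<^bsub>S\<^esub> c \<otimes>\<^bsub>S\<^esub> a = \<zero>\<^bsub>S\<^esub> \<longleftrightarrow> s \<otimes>\<^bsub>S\<^esub> a \<otimes>\<^bsub>S\<^esub> c = \<zero>\<^bsub>S\<^esub>"
    using sym s a c denom_mem unfolding symmetric_ring_def by blast
  also have "\<dots> \<longleftrightarrow> \<phi> (s \<otimes>\<^bsub>S\<^esub> a) \<otimes>\<^bsub>T\<^esub> \<phi> c = \<zero>\<^bsub>T\<^esub>"
    using s a c hom_eq_zero_iff[of "s \<otimes>\<^bsub>S\<^esub> a \<otimes>\<^bsub>S\<^esub> c"] by simp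
  also have "\<dots> \<longleftrightarrow> \<phi> (s \<otimes>\<^bsub>S\<^esub> a) = \<zero>\<^bsub>T\<^esub>"
    using unit_mult_zero_iff(2)[OF denom_unit[OF c]] s a by (simp del: hom_simps(2))
  also have "\<dots> \<longleftrightarrow> s \<otimes>\<^bsub>S\<^esub> a = \<zero>\<^bsub>S\<^esub>" using s a hom_eq_zero_iff by (simp del: hom_simps(2))
  finally show ?thesis .
qed

text \<open>Suppressing \<phi>, clear denominators in \<open>s c^-1\<close> to get
  \<open>d s = s' c\<close>. Then \<open>s c^-1 a = 0\<close> iff \<open>s' a = 0\<close> iff
  \<open>s' c a = 0\<close> iff \<open>d s a = 0\<close> iff \<open>s a = 0\<close>, the middle
  equivalence being the insertion of \<open>c\<close> allowed by symmetry.\<close>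

lemma middle_inv_denom:
  assumes sym: "symmetric_ring S"
    and s: "s \<in> carrier S" and c: "c \<in> C" and a: "a \<in> carrier S"
  shows "\<phi> s \<otimes>\<^bsub>T\<^esub> inv\<^bsub>T\<^esub> (\<phi> c) \<otimes>\<^bsub>T\<^esub> \<phi> a = \<zero>\<^bsub>T\<^esub> \<longleftrightarrow> \<phi> s \<otimes>\<^bsub>T\<^esub> \<phi> a = \<zero>\<^bsub>T\<^esub>"
proof -
  have u: "\<phi> c \<in> Units T" using c by (rule denom_unit)
  have t: "\<phi> s \<otimes>\<^bsub>T\<^esub> inv\<^bsub>T\<^esub> (\<phi> c) \<in> carrier T" using u s by simp
  obtain s' d where d: "s' \<in> carrier S" "d \<in> C" "\<phi> d \<otimes>\<^bsub>T\<^esub> (\<phi> s \<otimes>\<^bsub>T\<^esub> inv\<^bsub>T\<^esub> (\<phi> c)) = \<phi> s'"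
    using denom_ex[OF t] by blast
  have v: "\<phi> d \<in> Units T" using d denom_unit by blast
  \<comment> \<open>This is the left Ore condition for \<open>s\<close> and \<open>c\<close>, read
    off from a fraction for \<open>s c^-1\<close>.\<close>
  have ore: "\<phi> d \<otimes>\<^bsub>T\<^esub> \<phi> s = \<phi> s' \<otimes>\<^bsub>T\<^esub> \<phi> c"
    unfolding d(3)[symmetric] using u s d(2) by (simp add: T.m_assoc T.Units_closed)
  have "\<phi> s \<otimes>\<^bsub>T\<^esub> inv\<^bsub>T\<^esub> (\<phi> c) \<otimes>\<^bsub>T\<^esub> \<phi> a = \<zero>\<^bsub>T\<^esub> \<longleftrightarrow>
      \<phi> d \<otimes>\<^bsub>T\<^esub> (\<phi> s \<otimes>\<^bsub>T\<^esub> inv\<^bsub>T\<^esub> (\<phi> c) \<otimes>\<^bsub>T\<^esub> \<phi> a) = \<zero>\<^bsub>T\<^esub>"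
    using unit_mult_zero_iff(1)[OF v] t a by simp
  also have "\<phi> d \<otimes>\<^bsub>T\<^esub> (\<phi> s \<otimes>\<^bsub>T\<^esub> inv\<^bsub>T\<^esub> (\<phi> c) \<otimes>\<^bsub>T\<^esub> \<phi> a) = \<phi> (s' \<otimes>\<^bsub>S\<^esub> a)"
    using t a d by (simp add: T.m_assoc[symmetric])
  also have "\<phi> (s' \<otimes>\<^bsub>S\<^esub> a) = \<zero>\<^bsub>T\<^esub> \<longleftrightarrow> \<phi> (s' \<otimes>\<^bsub>S\<^esub> c \<otimes>\<^bsub>S\<^esub> a) = \<zero>\<^bsub>T\<^esub>"
    using symmetric_middle_denom[OF sym d(1) c a] d(1) c a
      hom_eq_zero_iff[of "s' \<otimes>\<^bsub>S\<^esub> a"] hom_eq_zero_iff[of "s' \<otimes>\<^bsub>S\<^esub> c \<otimes>\<^bsub>S\<^esub> a"]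
    by (simp del: hom_simps(2))
  also have "\<phi> (s' \<otimes>\<^bsub>S\<^esub> c \<otimes>\<^bsub>S\<^esub> a) = \<phi> d \<otimes>\<^bsub>T\<^esub> (\<phi> s \<otimes>\<^bsub>T\<^esub> \<phi> a)"
    using ore d s a c by (simp add: T.m_assoc[symmetric])
  also have "\<dots> = \<zero>\<^bsub>T\<^esub> \<longleftrightarrow> \<phi> s \<otimes>\<^bsub>T\<^esub> \<phi> a = \<zero>\<^bsub>T\<^esub>"
    using unit_mult_zero_iff(1)[OF v] s a by simp
  finally show ?thesis .
qed

text \<open>Extends the removal of \<open>c^-1\<close> from a right factor in \<open>S\<close> to
  any right factor \<open>t = d^-1 a\<close>. Two inverses then stand between \<open>s\<close> and
  \<open>a\<close>, and the previous lemma removes only one that follows an element of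
  \<open>S\<close> directly.\<close>

lemma middle_inv_denom':
  assumes sym: "symmetric_ring S"
    and s: "s \<in> carrier S" and c: "c \<in> C" and t: "t \<in> carrier T"
  shows "\<phi> s \<otimes>\<^bsub>T\<^esub> (inv\<^bsub>T\<^esub> (\<phi> c) \<otimes>\<^bsub>T\<^esub> t) = \<zero>\<^bsub>T\<^esub> \<longleftrightarrow> \<phi> s \<otimes>\<^bsub>T\<^esub> t = \<zero>\<^bsub>T\<^esub>"
proof -
  obtain a d where ad: "a \<in> carrier S" "d \<in> C" "t = inv\<^bsub>T\<^esub> (\<phi> d) \<otimes>\<^bsub>T\<^esub> \<phi> a"
    using t by (rule fraction)
  have u: "\<phi> c \<in> Units T" "\<phi> d \<in> Units T" using c ad denom_unit by auto
  have x: "\<phi> s \<otimes>\<^bsub>T\<^esub> inv\<^bsub>T\<^esub> (\<phi> c) \<in> carrier T" using u s by simp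
  obtain s' e where e: "s' \<in> carrier S" "e \<in> C"
    "\<phi> s \<otimes>\<^bsub>T\<^esub> inv\<^bsub>T\<^esub> (\<phi> c) = inv\<^bsub>T\<^esub> (\<phi> e) \<otimes>\<^bsub>T\<^esub> \<phi> s'"
    using x by (rule fraction)
  have v: "inv\<^bsub>T\<^esub> (\<phi> e) \<in> Units T" using e denom_unit by blast
  note cl = u(2) s ad(1) e(1) T.Units_closed[OF v]
  have "\<phi> s \<otimes>\<^bsub>T\<^esub> (inv\<^bsub>T\<^esub> (\<phi> c) \<otimes>\<^bsub>T\<^esub> t) = \<zero>\<^bsub>T\<^esub> \<longleftrightarrow>
      inv\<^bsub>T\<^esub> (\<phi> e) \<otimes>\<^bsub>T\<^esub> (\<phi> s' \<otimes>\<^bsub>T\<^esub> inv\<^bsub>T\<^esub> (\<phi> d) \<otimes>\<^bsub>T\<^esub> \<phi> a) = \<zero>\<^bsub>T\<^esub>"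
    using u(1) t cl e(3) ad(3) by (metis T.Units_inv_closed T.m_assoc T.m_closed hom_simps(1))
  also have "\<dots> \<longleftrightarrow> \<phi> s' \<otimes>\<^bsub>T\<^esub> inv\<^bsub>T\<^esub> (\<phi> d) \<otimes>\<^bsub>T\<^esub> \<phi> a = \<zero>\<^bsub>T\<^esub>"
    using cl by (intro unit_mult_zero_iff(1)[OF v]) simp
  also have "\<dots> \<longleftrightarrow> \<phi> s' \<otimes>\<^bsub>T\<^esub> \<phi> a = \<zero>\<^bsub>T\<^esub>" by (rule middle_inv_denom[OF sym e(1) ad(2,1)])
  also have "\<dots> \<longleftrightarrow> inv\<^bsub>T\<^esub> (\<phi> e) \<otimes>\<^bsub>T\<^esub> (\<phi> s' \<otimes>\<^bsub>T\<^esub> \<phi> a) = \<zero>\<^bsub>T\<^esub>"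
    using cl by (intro unit_mult_zero_iff(1)[OF v, symmetric]) simp
  also have "inv\<^bsub>T\<^esub> (\<phi> e) \<otimes>\<^bsub>T\<^esub> (\<phi> s' \<otimes>\<^bsub>T\<^esub> \<phi> a) = \<phi> s \<otimes>\<^bsub>T\<^esub> inv\<^bsub>T\<^esub> (\<phi> c) \<otimes>\<^bsub>T\<^esub> \<phi> a"
    unfolding e(3) using cl by (simp add: T.m_assoc)
  also have "\<dots> = \<zero>\<^bsub>T\<^esub> \<longleftrightarrow> \<phi> s \<otimes>\<^bsub>T\<^esub> \<phi> a = \<zero>\<^bsub>T\<^esub>" by (rule middle_inv_denom[OF sym s c ad(1)])
  also have "\<dots> \<longleftrightarrow> \<phi> s \<otimes>\<^bsub>T\<^esub> inv\<^bsub>T\<^esub> (\<phi> d) \<otimes>\<^bsub>T\<^esub> \<phi> a = \<zero>\<^bsub>T\<^esub>"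
    by (rule middle_inv_denom[OF sym s ad(2,1), symmetric])
  also have "\<phi> s \<otimes>\<^bsub>T\<^esub> inv\<^bsub>T\<^esub> (\<phi> d) \<otimes>\<^bsub>T\<^esub> \<phi> a = \<phi> s \<otimes>\<^bsub>T\<^esub> t"
    unfolding ad(3) using cl by (simp add: T.m_assoc)
  finally show ?thesis .
qed

text \<open>The inverses are removed from left to right: \<open>c^-1\<close> is a unit at the left
  end, while \<open>d^-1\<close> and then \<open>e^-1\<close> are interior denominators.\<close>

lemma triple_product_zero_iff:
  assumes sym: "symmetric_ring S"
    and s: "f \<in> carrier S" "g \<in> carrier S" "h \<in> carrier S" and c: "c \<in> C" "d \<in> C" "e \<in> C"
  shows "(inv\<^bsub>T\<^esub> (\<phi> c) \<otimes>\<^bsub>T\<^esub> \<phi> f) \<otimes>\<^bsub>T\<^esub> (inv\<^bsub>T\<^esub> (\<phi> d) \<otimes>\<^bsub>T\<^esub> \<phi> g) \<otimes>\<^bsub>T\<^esub> (inv\<^bsub>T\<^esub> (\<phi> e) \<otimes>\<^bsub>T\<^esub> \<phi> h) = \<zero>\<^bsub>T\<^esub>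
    \<longleftrightarrow> f \<otimes>\<^bsub>S\<^esub> g \<otimes>\<^bsub>S\<^esub> h = \<zero>\<^bsub>S\<^esub>" (is "?x = _ \<longleftrightarrow> _")
proof -
  have u: "\<phi> c \<in> Units T" "\<phi> d \<in> Units T" "\<phi> e \<in> Units T" using c denom_unit by auto
  have v: "inv\<^bsub>T\<^esub> (\<phi> c) \<in> Units T" using u by blast
  \<comment> \<open>This tail still contains \<open>e^-1\<close> and need not come from
    \<open>S\<close>, so dropping \<open>d^-1\<close> in front of it requires the version for
    arbitrary elements of \<open>T\<close>.\<close>
  let ?y = "\<phi> g \<otimes>\<^bsub>T\<^esub> (inv\<^bsub>T\<^esub> (\<phi> e) \<otimes>\<^bsub>T\<^esub> \<phi> h)"
  have y: "?y \<in> carrier T" using u s by simp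
  have "?x = inv\<^bsub>T\<^esub> (\<phi> c) \<otimes>\<^bsub>T\<^esub> (\<phi> f \<otimes>\<^bsub>T\<^esub> (inv\<^bsub>T\<^esub> (\<phi> d) \<otimes>\<^bsub>T\<^esub> ?y))"
    using u s by (simp add: T.m_assoc)
  also have "\<dots> = \<zero>\<^bsub>T\<^esub> \<longleftrightarrow> \<phi> f \<otimes>\<^bsub>T\<^esub> (inv\<^bsub>T\<^esub> (\<phi> d) \<otimes>\<^bsub>T\<^esub> ?y) = \<zero>\<^bsub>T\<^esub>"
    using u s y by (intro unit_mult_zero_iff(1)[OF v]) simp
  also have "\<dots> \<longleftrightarrow> \<phi> f \<otimes>\<^bsub>T\<^esub> ?y = \<zero>\<^bsub>T\<^esub>" by (rule middle_inv_denom'[OF sym s(1) c(2) y])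
  also have "\<phi> f \<otimes>\<^bsub>T\<^esub> ?y = \<phi> (f \<otimes>\<^bsub>S\<^esub> g) \<otimes>\<^bsub>T\<^esub> (inv\<^bsub>T\<^esub> (\<phi> e) \<otimes>\<^bsub>T\<^esub> \<phi> h)"
    using u s by (simp add: T.m_assoc)
  also have "\<dots> = \<zero>\<^bsub>T\<^esub> \<longleftrightarrow> \<phi> (f \<otimes>\<^bsub>S\<^esub> g) \<otimes>\<^bsub>T\<^esub> \<phi> h = \<zero>\<^bsub>T\<^esub>"
    using s c by (intro middle_inv_denom'[OF sym]) auto
  also have "\<dots> \<longleftrightarrow> \<phi> (f \<otimes>\<^bsub>S\<^esub> g \<otimes>\<^bsub>S\<^esub> h) = \<zero>\<^bsub>T\<^esub>" using s by simp
  also have "\<dots> \<longleftrightarrow> f \<otimes>\<^bsub>S\<^esub> g \<otimes>\<^bsub>S\<^esub> h = \<zero>\<^bsub>S\<^esub>" using s by (intro hom_eq_zero_iff) simp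
  finally show ?thesis .
qed

text \<open>Whether a triple product of fractions vanishes depends on the numerators alone, so the
  numerators can be permuted in \<open>S\<close>.\<close>

lemma symmetric_up:
  assumes sym: "symmetric_ring S" shows "symmetric_ring T"
  unfolding symmetric_ring_def
proof (intro ballI impI)
  fix x y z assume x: "x \<in> carrier T" and y: "y \<in> carrier T" and z: "z \<in> carrier T"
    and 0: "x \<otimes>\<^bsub>T\<^esub> y \<otimes>\<^bsub>T\<^esub> z = \<zero>\<^bsub>T\<^esub>"
  obtain f c where f: "f \<in> carrier S" "c \<in> C" "x = inv\<^bsub>T\<^esub> (\<phi> c) \<otimes>\<^bsub>T\<^esub> \<phi> f" using x by (rule fraction)
  obtain g d where g: "g \<in> carrier S" "d \<in> C" "y = inv\<^bsub>T\<^esub> (\<phi> d) \<otimes>\<^bsub>T\<^esub> \<phi> g" using y by (rule fraction)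
  obtain h e where h: "h \<in> carrier S" "e \<in> C" "z = inv\<^bsub>T\<^esub> (\<phi> e) \<otimes>\<^bsub>T\<^esub> \<phi> h" using z by (rule fraction)
  have "f \<otimes>\<^bsub>S\<^esub> g \<otimes>\<^bsub>S\<^esub> h = \<zero>\<^bsub>S\<^esub>"
    using 0 triple_product_zero_iff[OF sym f(1) g(1) h(1) f(2) g(2) h(2)] f(3) g(3) h(3) by simp
  then have "f \<otimes>\<^bsub>S\<^esub> h \<otimes>\<^bsub>S\<^esub> g = \<zero>\<^bsub>S\<^esub>" using sym f(1) g(1) h(1) unfolding symmetric_ring_def by blast
  then show "x \<otimes>\<^bsub>T\<^esub> z \<otimes>\<^bsub>T\<^esub> y = \<zero>\<^bsub>T\<^esub>"
    using triple_product_zero_iff[OF sym f(1) h(1) g(1) f(2) h(2) g(2)] f(3) g(3) h(3) by simp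
qed

theorem symmetric_iff: "symmetric_ring S \<longleftrightarrow> symmetric_ring T"
  using symmetric_up symmetric_down by blast

end

section \<open>Skew polynomials over the quotient ring\<close>

context skew_setup
begin

abbreviation const where "const a \<equiv> \<lambda>i::nat. if i = 0 then a else \<zero>"

lemma const_up [simp]: "a \<in> carrier T \<Longrightarrow> const a \<in> up T"
  by (rule mem_upI) (auto intro!: exI[of _ 0] bound.intro)

text \<open>Only the term \<open>i = 0\<close> survives, and there the twist is \<tau>^0, the
  identity. Hence a left denominator acts on each coefficient untwisted, whereas a constant factor
  on the right would be twisted by powers of \<tau>.\<close>

lemma smul_const_left:
  assumes a: "a \<in> carrier T" and q: "q \<in> up T"
  shows "smul (const a) q = (\<lambda>n. a \<otimes> q n)"
proof
  fix n
  have "smul (const a) q n = (\<Oplus>i\<in>{..n}. if i = 0 then a \<otimes> q n else \<zero>)"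
    using a q by (intro finsum_cong') auto
  also have "\<dots> = a \<otimes> q n"
    using a q add.finprod_singleton_swap[of 0 "{..n}" "\<lambda>_. a \<otimes> q n"] by simp
  finally show "smul (const a) q n = a \<otimes> q n" .
qed

lemma const_mult_left:
  assumes "a \<in> carrier T" "q \<in> up T"
  shows "const a \<otimes>\<^bsub>skew_poly T \<tau>\<^esub> q = (\<lambda>n. a \<otimes> q n)"
  using smul_const_left[OF assms] assms by (simp add: skew_poly_def)

lemma const_unit:
  assumes u: "u \<in> Units T" shows "const u \<in> Units (skew_poly T \<tau>)"
proof -
  have v: "inv u \<in> carrier T" "u \<in> carrier T" using u by auto
  have "const u \<otimes>\<^bsub>skew_poly T \<tau>\<^esub> const (inv u) = \<one>\<^bsub>skew_poly T \<tau>\<^esub>"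
    "const (inv u) \<otimes>\<^bsub>skew_poly T \<tau>\<^esub> const u = \<one>\<^bsub>skew_poly T \<tau>\<^esub>"
    using u v by (auto simp: const_mult_left) (auto simp: skew_poly_def fun_eq_iff)
  then show ?thesis using v unfolding Units_def by (auto simp: skew_poly_def)
qed

end

context quotient_setup
begin

section \<open>Coefficientwise embedding of skew polynomials\<close>

sublocale SR: skew_setup R \<sigma>
  by unfold_locales (rule sigma_hom)

sublocale SQ: skew_setup Q sbar
  by unfold_locales (rule sbar_hom)

text \<open>View \<open>a\<close> as a fraction with denominator 1.\<close>

lemma sbar_iota: "a \<in> carrier R \<Longrightarrow> sbar (\<iota> a) = \<iota> (\<sigma> a)"
  using sbar_transfer[of "\<iota> a" "\<one>\<^bsub>R\<^esub>" a] sbar_closed[of "\<iota> a"] by simp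

lemma sbar_funpow_iota: "a \<in> carrier R \<Longrightarrow> (sbar ^^ i) (\<iota> a) = \<iota> ((\<sigma> ^^ i) a)"
  by (induction i) (simp_all add: sbar_iota)

lemma iota_finsum:
  "finite A \<Longrightarrow> f \<in> A \<rightarrow> carrier R \<Longrightarrow> \<iota> (finsum R f A) = finsum Q (\<lambda>j. \<iota> (f j)) A"
proof (induction A rule: finite_induct)
  case (insert x F)
  moreover have "(\<lambda>j. \<iota> (f j)) \<in> F \<rightarrow> carrier Q"
    using insert by (intro Pi_I iota_simps(1)) auto
  ultimately show ?case by simp
qed simp

lemma iota_comp_up [simp]:
  assumes "p \<in> up R" shows "\<iota> \<circ> p \<in> up Q"
proof (rule mem_upI)
  obtain n where "bound \<zero>\<^bsub>R\<^esub> n p" using assms by blast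
  then have "bound \<zero>\<^bsub>Q\<^esub> n (\<iota> \<circ> p)" by (auto intro!: bound.intro dest: bound.bound)
  then show "\<exists>n. bound \<zero>\<^bsub>Q\<^esub> n (\<iota> \<circ> p)" ..
qed (use assms in simp)

text \<open>Multiplicativity holds because \<open>sbar\<close> extends \<sigma>: \<iota> carries the
  twist \<sigma>^i in each product term to \<open>sbar^i\<close>.\<close>

lemma iota_comp_hom: "(\<circ>) \<iota> \<in> ring_hom (skew_poly R \<sigma>) (skew_poly Q sbar)"
proof (rule ring_hom_memI)
  fix p q assume "p \<in> carrier (skew_poly R \<sigma>)" "q \<in> carrier (skew_poly R \<sigma>)"
  then have c: "p \<in> up R" "q \<in> up R" by (simp_all add: skew_poly_def)
  have "\<iota> (SR.smul p q n) = SQ.smul (\<iota> \<circ> p) (\<iota> \<circ> q) n" for n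
    using c by (subst iota_finsum)
      (auto simp: sbar_funpow_iota intro!: Q.finsum_cong')
  then show "\<iota> \<circ> (p \<otimes>\<^bsub>skew_poly R \<sigma>\<^esub> q) = (\<iota> \<circ> p) \<otimes>\<^bsub>skew_poly Q sbar\<^esub> (\<iota> \<circ> q)"
    using c by (simp add: skew_poly_def fun_eq_iff)
  show "\<iota> \<circ> (p \<oplus>\<^bsub>skew_poly R \<sigma>\<^esub> q) = (\<iota> \<circ> p) \<oplus>\<^bsub>skew_poly Q sbar\<^esub> (\<iota> \<circ> q)"
    using c by (simp add: skew_poly_def fun_eq_iff)
qed (auto simp: skew_poly_def fun_eq_iff)

section \<open>Common denominators\<close>

lemma regular_mult:
  assumes b: "b \<in> regular_elements R" and c: "c \<in> regular_elements R"
  shows "b \<otimes>\<^bsub>R\<^esub> c \<in> regular_elements R"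
proof (rule regularI)
  fix r assume r: "r \<in> carrier R"
  show "r = \<zero>\<^bsub>R\<^esub>" if "b \<otimes>\<^bsub>R\<^esub> c \<otimes>\<^bsub>R\<^esub> r = \<zero>\<^bsub>R\<^esub>"
    using that b c r regularD(1)[OF b, of "c \<otimes>\<^bsub>R\<^esub> r"] regularD(1)[OF c r] by (simp add: R.m_assoc)
  show "r = \<zero>\<^bsub>R\<^esub>" if "r \<otimes>\<^bsub>R\<^esub> (b \<otimes>\<^bsub>R\<^esub> c) = \<zero>\<^bsub>R\<^esub>"
    using that b c r regularD(2)[OF c, of "r \<otimes>\<^bsub>R\<^esub> b"] regularD(2)[OF b r]
    by (simp add: R.m_assoc[symmetric])
qed (use b c in simp)

lemma one_regular: "\<one>\<^bsub>R\<^esub> \<in> regular_elements R"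
  by (rule regularI) auto

text \<open>Induction on the index set: the left Ore condition merges the denominator found so far
  with that of the new element.\<close>

lemma common_denominator:
  fixes I :: "'i set"
  assumes "finite I" "\<And>i. i \<in> I \<Longrightarrow> q i \<in> carrier Q"
  shows "\<exists>c\<in>regular_elements R. \<forall>i\<in>I. \<iota> c \<otimes>\<^bsub>Q\<^esub> q i \<in> \<iota> ` carrier R"
  using assms
proof (induction I rule: finite_induct)
  case empty then show ?case using one_regular by blast
next
  case (insert j F)
  obtain c where c: "c \<in> regular_elements R" "\<forall>i\<in>F. \<iota> c \<otimes>\<^bsub>Q\<^esub> q i \<in> \<iota> ` carrier R"
    using insert by auto
  obtain a b where ab: "a \<in> carrier R" "b \<in> regular_elements R" "\<iota> b \<otimes>\<^bsub>Q\<^esub> q j = \<iota> a"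
    using denomE[of "q j"] insert.prems by auto
  \<comment> \<open>The element \<open>e c = f b\<close> is a left multiple of both denominators. It
    is regular as the product of \<open>e\<close> and \<open>c\<close>, although \<open>f\<close>
    need not be regular.\<close>
  obtain e f where ef: "e \<in> regular_elements R" "f \<in> carrier R" "e \<otimes>\<^bsub>R\<^esub> c = f \<otimes>\<^bsub>R\<^esub> b"
    using left_ore[of c b] c ab by auto
  have "\<iota> (e \<otimes>\<^bsub>R\<^esub> c) \<otimes>\<^bsub>Q\<^esub> q i \<in> \<iota> ` carrier R" if "i \<in> insert j F" for i
  proof (cases "i = j")
    case True
    have "\<iota> (e \<otimes>\<^bsub>R\<^esub> c) \<otimes>\<^bsub>Q\<^esub> q j = \<iota> (f \<otimes>\<^bsub>R\<^esub> a)"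
      unfolding ef(3) using ef(2) ab insert.prems[of j] by (simp add: Q.m_assoc)
    then show ?thesis using True ef ab by (intro image_eqI[of _ _ "f \<otimes>\<^bsub>R\<^esub> a"]) auto
  next
    case False
    then have "i \<in> F" using that by simp
    then obtain r where r: "r \<in> carrier R" "\<iota> c \<otimes>\<^bsub>Q\<^esub> q i = \<iota> r" using c(2) by blast
    have "\<iota> (e \<otimes>\<^bsub>R\<^esub> c) \<otimes>\<^bsub>Q\<^esub> q i = \<iota> (e \<otimes>\<^bsub>R\<^esub> r)"
      using ef(1) c(1) r insert.prems[OF that] by (simp add: Q.m_assoc)
    then show ?thesis using ef r by (intro image_eqI[of _ _ "e \<otimes>\<^bsub>R\<^esub> r"]) auto
  qed
  then show ?case using regular_mult[OF ef(1) c(1)] by blast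
qed

lemma common_denominator_up:
  assumes q: "q \<in> up Q"
  obtains p c where "p \<in> up R" "c \<in> regular_elements R" "\<And>n. \<iota> c \<otimes>\<^bsub>Q\<^esub> q n = \<iota> (p n)"
proof -
  obtain n where n: "bound \<zero>\<^bsub>Q\<^esub> n q" using q by blast
  obtain c where c: "c \<in> regular_elements R" "\<forall>i\<in>{..n}. \<iota> c \<otimes>\<^bsub>Q\<^esub> q i \<in> \<iota> ` carrier R"
    using common_denominator[of "{..n}" q] q by auto
  \<comment> \<open>Injectivity of \<iota> makes the numerators unique. Setting them to zero beyond
    \<open>n\<close> gives finite support and agrees with the vanishing coefficients of
    \<open>q\<close> there.\<close>
  define p where "p i = (if i \<le> n then inv_into (carrier R) \<iota> (\<iota> c \<otimes>\<^bsub>Q\<^esub> q i) else \<zero>\<^bsub>R\<^esub>)" for i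
  have "p \<in> up R"
  proof (rule mem_upI)
    show "p i \<in> carrier R" for i using c(2) by (auto simp: p_def intro: inv_into_into)
    show "\<exists>n. bound \<zero>\<^bsub>R\<^esub> n p" by (rule exI[of _ n]) (auto simp: p_def)
  qed
  moreover have "\<iota> c \<otimes>\<^bsub>Q\<^esub> q i = \<iota> (p i)" for i
  proof (cases "i \<le> n")
    case True then show ?thesis using c(2) by (simp add: p_def f_inv_into_f)
  next
    case False
    then have "q i = \<zero>\<^bsub>Q\<^esub>" using bound.bound[OF n, of i] by simp
    then show ?thesis using False c(1) by (simp add: p_def)
  qed
  ultimately show ?thesis using that c(1) by blast
qed

text \<open>Constants from regular elements of \<open>R\<close> become units since their inverses in
  \<open>Q\<close> give inverse constants. Multiplying by a common denominator of the coefficients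
  carries any skew polynomial over \<open>Q\<close> into the image of
  \<open>R[x;\<sigma>]\<close>.\<close>

lemma skew_left_fractions:
  "left_fractions (skew_poly R \<sigma>) (skew_poly Q sbar) ((\<circ>) \<iota>) (SR.const ` regular_elements R)"
proof -
  interpret A: ring "skew_poly R \<sigma>" by (rule SR.skew_poly_ring)
  interpret B: ring "skew_poly Q sbar" by (rule SQ.skew_poly_ring)
  have comp_const: "\<iota> \<circ> SR.const c = SQ.const (\<iota> c)" for c by (auto simp: fun_eq_iff)
  show ?thesis
  proof unfold_locales
    show "inj_on ((\<circ>) \<iota>) (carrier (skew_poly R \<sigma>))"
    proof (rule inj_onI)
      fix p q assume "p \<in> carrier (skew_poly R \<sigma>)" "q \<in> carrier (skew_poly R \<sigma>)"
      then have "p i \<in> carrier R" "q i \<in> carrier R" for i by (simp_all add: skew_poly_def)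
      moreover assume "\<iota> \<circ> p = \<iota> \<circ> q"
      ultimately show "p = q" by (auto simp: fun_eq_iff intro: iota_inj_eq)
    qed
    show "SR.const ` regular_elements R \<subseteq> carrier (skew_poly R \<sigma>)"
      using SR.const_up by (auto simp: skew_poly_def)
    show "\<iota> \<circ> c \<in> Units (skew_poly Q sbar)" if "c \<in> SR.const ` regular_elements R" for c
      using that SQ.const_unit iota_unit comp_const by auto
    show "\<exists>a\<in>carrier (skew_poly R \<sigma>). \<exists>c\<in>SR.const ` regular_elements R.
        (\<iota> \<circ> c) \<otimes>\<^bsub>skew_poly Q sbar\<^esub> t = \<iota> \<circ> a" if "t \<in> carrier (skew_poly Q sbar)" for t
    proof -
      have t: "t \<in> up Q" using that by (simp add: skew_poly_def)
      obtain p c where p: "p \<in> up R" "c \<in> regular_elements R" "\<And>n. \<iota> c \<otimes>\<^bsub>Q\<^esub> t n = \<iota> (p n)"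
        using t by (rule common_denominator_up) blast
      have "(\<iota> \<circ> SR.const c) \<otimes>\<^bsub>skew_poly Q sbar\<^esub> t = \<iota> \<circ> p"
        unfolding comp_const using SQ.const_mult_left[of "\<iota> c" t] p t by (simp add: fun_eq_iff)
      moreover have "p \<in> carrier (skew_poly R \<sigma>)" using p by (simp add: skew_poly_def)
      ultimately show ?thesis using p(2) by blast
    qed
  qed (rule iota_comp_hom)
qed

end

theorem theorem3p3:
  fixes R :: "('a, 'm) ring_scheme" and Q :: "('b, 'n) ring_scheme"
    and \<iota> :: "'a \<Rightarrow> 'b" and \<sigma> :: "'a \<Rightarrow> 'a"
  assumes "ring R"
    and "\<sigma> \<in> ring_iso R R"
    and "\<exists>r\<in>carrier R. \<sigma> r \<noteq> r"
    and "\<exists>r\<in>carrier R. \<sigma> r \<noteq> \<zero>\<^bsub>R\<^esub>"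
    and "classical_left_quotient_ring R Q \<iota>"
  shows "strongly_symmetric R \<sigma> \<longleftrightarrow>
    strongly_symmetric Q (quotient_extension R Q \<iota> \<sigma>)"
proof -
  have "ring Q" using assms(5) by (simp add: classical_left_quotient_ring_def)
  then interpret quotient_setup R Q \<iota> \<sigma>
    using assms by (simp add: quotient_setup_def quotient_setup_axioms_def)
  \<comment> \<open>Strong symmetry is symmetry of the skew polynomial ring, so this fraction
    structure reduces the claim to \<open>symmetric_iff\<close>.\<close>
  interpret left_fractions "skew_poly R \<sigma>" "skew_poly Q sbar" "(\<circ>) \<iota>"
    "SR.const ` regular_elements R"
    by (rule skew_left_fractions)
  show ?thesis unfolding strongly_symmetric_def by (rule symmetric_iff)
qed

end
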